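(* Let $y_1,\dots,y_l$ and $z_1,\dots,z_m$ be sequences of distinct points in $D$. Then $$(\hat e(y_1)\cdots\hat e(y_l)\mathbf 1,\ \hat e(z_1)\cdots\hat e(z_m)\mathbf 1)=\begin{cases}0&\text{if }l\ne m,\\[4pt] \displaystyle\sum_\sigma\frac1{(1-u(z_1)\overline{u}(y_{\sigma(1)}))^2}\cdots\frac1{(1-u(z_l)\overline u(y_{\sigma(l)}))^2}&\text{if }l=m,\end{cases}$$ where the sum runs over all permutations $\sigma$ of $(1,\dots,l)$.
   Context: $\mathbb P$ is a complex projective line with canonical bundle $K$, $C:\mathbb P\to\mathbb P$ is the antiholomorphic involution which in a coordinate $u$ is $u(C(z))=1/\overline{u(z)}$. $D=\{|u|<1\}$, $D'=C(D)$ is the complement of its closure. ${}_D\mathbf K$ is the space of meromorphic 1-forms on $\mathbb P$ with all residues zero and all poles in $D$; ${}_D\mathbf W=S^*({}_D\mathbf K)$, with vacuum $\mathbf 1=1\in\mathbb C$. For $z\in D$, $\hat e(z):{}_D\mathbf W\to{}_D\mathbf W$ is multiplication by $-\frac{du}{(u-u(z))^2}$. For $z\notin D$, $z\neq$ the pole of $u$, $\hat i(z):{}_D\mathbf W\to{}_D\mathbf W$ is the derivation with $\hat i(z)\mathbf 1=0$ and $\hat i(z)(a\,du)=-a(z)$ for $a\,du\in{}_D\mathbf K$. $(\cdot,\cdot)$ is the hermitian form on ${}_D\mathbf W$ (antilinear in the first argument, linear in the second), compatible with derivatives of the fields in $z$, characterised by $(\mathbf 1,\mathbf 1)=1$, $u(z)^2(\chi,\hat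 e(z)\psi)=(\hat i(C(z))\chi,\psi)$ for $z\in D$ (at $u(z)=0$ by continuity: $(\chi,\hat e(z)\psi)$ is holomorphic in $z\in D$), and $u(z')^2(\chi,\hat i(z')\psi)=(\hat e(C(z'))\chi,\psi)$ for $z'\in D'$, for all $\chi,\psi\in{}_D\mathbf W$. $\overline u(y)$ denotes $\overline{u(y)}$. *)

theory Defs
  imports
    "HOL-Complex_Analysis.Complex_Analysis"
    "HOL-Library.Poly_Mapping"
    "HOL-Library.Multiset"
    "HOL-Combinatorics.Permutations"
begin

section \<open>The projective line, its involution and its meromorphic 1-forms\<close>

text \<open>
  The projective line, written in its coordinate \<open>u\<close>; \<open>Infty\<close> is the pole of \<open>u\<close>
  (where the selector \<open>u\<close> is left unspecified).
\<close>

datatype proj_line = Aff (u: complex) | Infty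

fun invol :: "proj_line \<Rightarrow> proj_line" where
  "invol Infty = Aff 0"
| "invol (Aff z) = (if z = 0 then Infty else Aff (1 / cnj z))"

definition disc :: "proj_line set" where
  "disc = {z. z \<noteq> Infty \<and> norm (u z) < 1}"

definition codisc :: "proj_line set" where
  "codisc = invol ` disc"

text \<open>
  A 1-form is encoded by its coefficient \<open>a\<close>, i.e. it is \<open>a du\<close>. Near the pole of \<open>u\<close> the
  local coordinate is \<open>t = 1/u\<close>, and there \<open>a du = - a (1/t) / t\<^sup>2 dt\<close>.
\<close>

fun local_coeff :: "(complex \<Rightarrow> complex) \<Rightarrow> proj_line \<Rightarrow> complex \<Rightarrow> complex" where
  "local_coeff a (Aff z) = a"
| "local_coeff a Infty = (\<lambda>t. - a (1 / t) / t\<^sup>2)"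

fun local_coord :: "proj_line \<Rightarrow> complex" where
  "local_coord (Aff z) = z"
| "local_coord Infty = 0"

definition form_residue :: "(complex \<Rightarrow> complex) \<Rightarrow> proj_line \<Rightarrow> complex" where
  "form_residue a p = residue (local_coeff a p) (local_coord p)"

definition form_pole :: "(complex \<Rightarrow> complex) \<Rightarrow> proj_line \<Rightarrow> bool" where
  "form_pole a p \<longleftrightarrow> is_pole (local_coeff a p) (local_coord p)"

text \<open>
  \<^const>\<open>nicely_meromorphic_on\<close> fixes the values of the coefficient at its singularities
  (removable ones are removed, the value at a pole is 0), so that a 1-form has exactly one
  representative \<open>a\<close>.
\<close>

definition meromorphic_form :: "(complex \<Rightarrow> complex) \<Rightarrow> bool" where
  "meromorphic_form a \<longleftrightarrow>
     a nicely_meromorphic_on UNIV \<and>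
     (\<forall>p. local_coeff a p meromorphic_on {local_coord p})"

definition DK_coeffs :: "(complex \<Rightarrow> complex) set" where
  "DK_coeffs = {a. meromorphic_form a \<and>
     (\<forall>p. form_residue a p = 0) \<and> (\<forall>p. form_pole a p \<longrightarrow> p \<in> disc)}"

lemma Aff_in_disc [simp]: "Aff z \<in> disc \<longleftrightarrow> norm z < 1"
  and Infty_notin_disc [simp]: "Infty \<notin> disc"
  by (simp_all add: disc_def)

lemma codisc_eq: "codisc = {z. z = Infty \<or> norm (u z) > 1}"
proof (intro set_eqI iffI)
  fix p assume "p \<in> codisc"
  then obtain q where q: "q \<in> disc" "p = invol q" by (auto simp: codisc_def)
  show "p \<in> {z. z = Infty \<or> norm (u z) > 1}"
  proof (cases q)
    case (Aff z)
    with q have "norm z < 1" by simp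
    then show ?thesis by (simp add: q Aff norm_divide)
  qed (use q in simp)
next
  fix p assume p: "p \<in> {z. z = Infty \<or> norm (u z) > 1}"
  show "p \<in> codisc"
  proof (cases p)
    case (Aff z)
    with p have "norm z > 1" by simp
    then have "z \<noteq> 0" "Aff (1 / cnj z) \<in> disc" "invol (Aff (1 / cnj z)) = Aff z"
      by (auto simp: norm_divide divide_simps)
    then show ?thesis unfolding codisc_def Aff by (metis image_eqI)
  next
    case Infty
    have "invol (Aff 0) = Infty" "Aff 0 \<in> disc" by simp_all
    then show ?thesis unfolding codisc_def Infty by (metis image_eqI)
  qed
qed

lemma DK_analytic:
  assumes "a \<in> DK_coeffs" "norm z \<ge> 1"
  shows "a analytic_on {z}"
proof (rule nicely_meromorphic_on_imp_analytic_at[of _ UNIV])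
  show "\<not> is_pole a z"
  proof
    assume "is_pole a z"
    then have "form_pole a (Aff z)" by (simp add: form_pole_def)
    with assms show False by (auto simp: DK_coeffs_def)
  qed
qed (use assms in \<open>auto simp: DK_coeffs_def meromorphic_form_def\<close>)

lemma residue_add_meromorphic:
  assumes "f meromorphic_on {z}" "g meromorphic_on {z}"
  shows "residue (\<lambda>w. f w + g w) z = residue f z + residue g z"
proof -
  obtain r where r: "r > 0" "f analytic_on ball z r - {z}"
    using meromorphic_on_isolated_singularity[OF assms(1)] by (auto simp: isolated_singularity_at_def)
  obtain s where s: "s > 0" "g analytic_on ball z s - {z}"
    using meromorphic_on_isolated_singularity[OF assms(2)] by (auto simp: isolated_singularity_at_def)
  show ?thesis
  proof (rule residue_add[of "ball z (min r s)"])
    show "f holomorphic_on ball z (min r s) - {z}"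
      by (rule analytic_imp_holomorphic, rule analytic_on_subset[OF r(2)]) auto
    show "g holomorphic_on ball z (min r s) - {z}"
      by (rule analytic_imp_holomorphic, rule analytic_on_subset[OF s(2)]) auto
  qed (use r s in auto)
qed

lemma residue_cmult_meromorphic:
  assumes "f meromorphic_on {z}"
  shows "residue (\<lambda>w. c * f w) z = c * residue f z"
proof -
  obtain r where r: "r > 0" "f analytic_on ball z r - {z}"
    using meromorphic_on_isolated_singularity[OF assms] by (auto simp: isolated_singularity_at_def)
  show ?thesis
    by (rule residue_lmul[of "ball z r"]) (use r analytic_imp_holomorphic in auto)
qed

lemma meromorphic_no_pole_limit:
  assumes "f meromorphic_on {z}" "\<not> is_pole f z"
  obtains c where "f \<midarrow>z\<rightarrow> c"
  using meromorphic_on_not_essential[OF assms(1)] assms(2) unfolding not_essential_def by auto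

lemma limit_imp_no_pole: "f \<midarrow>z\<rightarrow> c \<Longrightarrow> \<not> is_pole f z" for f :: "complex \<Rightarrow> complex"
  unfolding is_pole_def by (meson at_neq_bot not_tendsto_and_filterlim_at_infinity)

lemma is_pole_addD:
  assumes "f meromorphic_on {z}" "g meromorphic_on {z}" "is_pole (\<lambda>w. f w + g w) z"
  shows "is_pole f z \<or> is_pole g z"
  by (meson assms limit_imp_no_pole meromorphic_no_pole_limit tendsto_add)

lemma is_pole_cmultD:
  assumes "f meromorphic_on {z}" "is_pole (\<lambda>w. c * f w) z"
  shows "is_pole f z"
  by (meson assms limit_imp_no_pole meromorphic_no_pole_limit tendsto_mult_left)

lemma DK_remove_sings:
  assumes loc: "\<And>p. local_coeff a p meromorphic_on {local_coord p}"
    and res: "\<And>p. form_residue a p = 0"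
    and pole: "\<And>p. form_pole a p \<Longrightarrow> p \<in> disc"
    and ana: "\<And>z. norm z \<ge> 1 \<Longrightarrow> a analytic_on {z}"
  shows "remove_sings a \<in> DK_coeffs"
proof -
  have mero: "a meromorphic_on UNIV"
    using loc[of "Aff _"] by (simp add: meromorphic_on_def)
  have sing: "isolated_singularity_at a z" for z
    using loc[of "Aff z"] by (simp add: meromorphic_on_isolated_singularity)
  have ev: "eventually (\<lambda>w. local_coeff (remove_sings a) p w = local_coeff a p w) (at (local_coord p))" for p
  proof (cases p)
    case (Aff z)
    then show ?thesis using eventually_remove_sings_eq_at[OF sing] by simp
  next
    case Infty
    have "eventually (\<lambda>t. t \<in> ball 0 1 - {0}) (at (0::complex))"
      by (intro eventually_at_in_open) auto
    then have "eventually (\<lambda>t. - remove_sings a (1 / t) / t\<^sup>2 = - a (1 / t) / t\<^sup>2) (at 0)"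
    proof eventually_elim
      case (elim t)
      then have "norm (1 / t) \<ge> 1" by (auto simp: norm_divide divide_simps)
      then show ?case using ana by simp
    qed
    then show ?thesis by (simp add: Infty)
  qed
  have "local_coeff (remove_sings a) p meromorphic_on {local_coord p}" for p
    using meromorphic_on_cong[OF _ refl, of "{local_coord p}"] ev loc by (metis singletonD)
  moreover have "form_residue (remove_sings a) p = 0" for p
    using res residue_cong[OF ev refl] by (simp add: form_residue_def)
  moreover have "form_pole (remove_sings a) p \<Longrightarrow> p \<in> disc" for p
    using pole is_pole_cong[OF ev refl] by (simp add: form_pole_def)
  ultimately show ?thesis
    using remove_sings_nicely_meromorphic[OF mero] by (auto simp: DK_coeffs_def meromorphic_form_def)
qed

lemma local_coeff_add: "local_coeff (\<lambda>w. a w + b w) p = (\<lambda>w. local_coeff a p w + local_coeff b p w)"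
  by (cases p) (auto simp: diff_divide_distrib)

lemma local_coeff_cmult: "local_coeff (\<lambda>w. c * a w) p = (\<lambda>w. c * local_coeff a p w)"
  by (cases p) auto

lemma DK_coeffs_add:
  assumes "a \<in> DK_coeffs" "b \<in> DK_coeffs"
  shows "remove_sings (\<lambda>w. a w + b w) \<in> DK_coeffs"
proof -
  have m: "local_coeff a p meromorphic_on {local_coord p}" "local_coeff b p meromorphic_on {local_coord p}" for p
    using assms by (auto simp: DK_coeffs_def meromorphic_form_def)
  show ?thesis
  proof (rule DK_remove_sings)
    fix p
    show "local_coeff (\<lambda>w. a w + b w) p meromorphic_on {local_coord p}"
      unfolding local_coeff_add by (intro meromorphic_intros m)
    show "form_residue (\<lambda>w. a w + b w) p = 0"
      using assms by (simp add: form_residue_def local_coeff_add residue_add_meromorphic m DK_coeffs_def)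
    show "form_pole (\<lambda>w. a w + b w) p \<Longrightarrow> p \<in> disc"
      using assms is_pole_addD[OF m(1)[of p] m(2)[of p]] by (auto simp: form_pole_def local_coeff_add DK_coeffs_def)
  next
    fix z :: complex assume "norm z \<ge> 1"
    then show "(\<lambda>w. a w + b w) analytic_on {z}"
      by (intro analytic_intros DK_analytic assms)
  qed
qed

lemma DK_coeffs_cmult:
  assumes "a \<in> DK_coeffs"
  shows "(\<lambda>w. c * a w) \<in> DK_coeffs"
proof -
  have m: "local_coeff a p meromorphic_on {local_coord p}" for p
    using assms by (auto simp: DK_coeffs_def meromorphic_form_def)
  have "(\<lambda>w. c * a w) nicely_meromorphic_on UNIV"
    using assms by (auto simp: DK_coeffs_def meromorphic_form_def)
  moreover have "local_coeff (\<lambda>w. c * a w) p meromorphic_on {local_coord p}" for p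
    unfolding local_coeff_cmult by (intro meromorphic_intros m)
  moreover have "form_residue (\<lambda>w. c * a w) p = 0" for p
    using assms by (simp add: form_residue_def local_coeff_cmult residue_cmult_meromorphic m DK_coeffs_def)
  moreover have "form_pole (\<lambda>w. c * a w) p \<Longrightarrow> p \<in> disc" for p
    using assms is_pole_cmultD[OF m] by (auto simp: form_pole_def local_coeff_cmult DK_coeffs_def)
  ultimately show ?thesis by (auto simp: DK_coeffs_def meromorphic_form_def)
qed

lemma DK_coeffs_pole_form:
  assumes "norm z < 1"
  shows "(\<lambda>w. c / (w - z) ^ (n + 2)) \<in> DK_coeffs"
proof (cases "c = 0")
  case True
  have "(\<lambda>w. 0) \<in> DK_coeffs"
  proof -
    have "local_coeff (\<lambda>w. 0) p = (\<lambda>w. 0)" for p by (cases p) auto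
    then show ?thesis
      by (auto simp: DK_coeffs_def meromorphic_form_def form_residue_def form_pole_def
          analytic_at_imp_no_pole residue_const)
  qed
  then show ?thesis using True by simp
next
  case c: False
  let ?a = "\<lambda>w. c / (w - z) ^ (n + 2)"
  have ana: "?a analytic_on {w}" if "w \<noteq> z" for w
    using that by (intro analytic_intros) auto
  have pole: "is_pole ?a z"
    using is_pole_basic[of "\<lambda>_. c" UNIV z "n + 2"] c by simp
  have nice: "?a nicely_meromorphic_on UNIV"
    unfolding nicely_meromorphic_on_def
  proof (intro conjI ballI)
    show "?a meromorphic_on UNIV" by (intro meromorphic_intros)
    show "is_pole ?a w \<and> ?a w = 0 \<or> ?a \<midarrow>w\<rightarrow> ?a w" for w
    proof (cases "w = z")
      case True
      then show ?thesis using pole by simp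
    next
      case False
      then show ?thesis using analytic_at_imp_isCont[OF ana[OF False]] by (simp add: isCont_def)
    qed
  qed
  let ?b = "\<lambda>t. - c * t ^ n / (1 - z * t) ^ (n + 2)"
  have b: "?b analytic_on {0}" by (intro analytic_intros) auto
  have ev: "eventually (\<lambda>t. local_coeff ?a Infty t = ?b t) (at 0)"
  proof -
    have "eventually (\<lambda>t. t \<in> ball 0 1 - {0}) (at (0::complex))"
      by (intro eventually_at_in_open) auto
    then show ?thesis
    proof eventually_elim
      case (elim t)
      then have "t \<noteq> 0" by auto
      then have "1 / t - z = (1 - z * t) / t" by (simp add: field_simps)
      then show ?case using \<open>t \<noteq> 0\<close> by (simp add: power_divide power_add power2_eq_square)
    qed
  qed
  have loc: "local_coeff ?a p meromorphic_on {local_coord p}" for p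
  proof (cases p)
    case (Aff w)
    then show ?thesis by (auto intro!: meromorphic_intros)
  next
    case Infty
    have "?b meromorphic_on {0}" using b by (rule analytic_on_imp_meromorphic_on)
    then show ?thesis
      using meromorphic_on_cong[OF _ refl, of "{0}" "local_coeff ?a Infty" ?b] ev Infty by simp
  qed
  have res: "form_residue ?a p = 0" for p
  proof (cases p)
    case (Aff w)
    show ?thesis
    proof (cases "w = z")
      case True
      have "residue (\<lambda>w. c / (w - z) ^ Suc (n + 1)) z = (deriv ^^ (n + 1)) (\<lambda>_. c) z / fact (n + 1)"
        by (rule residue_holomorphic_over_power[of UNIV]) auto
      then show ?thesis by (simp add: form_residue_def Aff True)
    next
      case False
      then show ?thesis
        using ana[OF False] residue_holo unfolding form_residue_def Aff analytic_at by auto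
    qed
  next
    case Infty
    have "residue ?b 0 = 0" using b residue_holo unfolding analytic_at by blast
    then show ?thesis using residue_cong[OF ev refl] by (simp add: form_residue_def Infty)
  qed
  have "p \<in> disc" if p: "form_pole ?a p" for p
  proof (cases p)
    case (Aff w)
    then show ?thesis
      using p ana[of w] analytic_at_imp_no_pole assms by (cases "w = z") (auto simp: form_pole_def)
  next
    case Infty
    then show ?thesis
      using p analytic_at_imp_no_pole[OF b] is_pole_cong[OF ev refl]
      unfolding Infty form_pole_def local_coord.simps by blast
  qed
  then show ?thesis using nice loc res by (auto simp: DK_coeffs_def meromorphic_form_def)
qed

typedef DK = DK_coeffs
  morphisms form_coeff Abs_DK
  using DK_coeffs_pole_form[of 0 0 0] by auto

setup_lifting type_definition_DK

lift_definition DK_add :: "DK \<Rightarrow> DK \<Rightarrow> DK" is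
  "\<lambda>a b. remove_sings (\<lambda>w. a w + b w)"
  by (rule DK_coeffs_add)

lift_definition DK_scale :: "complex \<Rightarrow> DK \<Rightarrow> DK" is
  "\<lambda>c a w. c * a w"
  by (rule DK_coeffs_cmult)

text \<open>
  For \<open>z\<close> in the disc, \<open>pole_form n z\<close> is the \<open>n\<close>-th derivative with respect to \<open>u(z)\<close> of
  \<open>- du / (u - u(z))\<^sup>2\<close>. For other \<open>z\<close> it is set to 0.
\<close>

lift_definition pole_form :: "nat \<Rightarrow> proj_line \<Rightarrow> DK" is
  "\<lambda>n z. if z \<in> disc then (\<lambda>w. - fact (n + 1) / (w - u z) ^ (n + 2)) else (\<lambda>w. 0)"
proof -
  fix n z
  have "(\<lambda>w. 0) \<in> DK_coeffs" using DK_coeffs_pole_form[of 0 0] by simp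
  then show "(if z \<in> disc then (\<lambda>w. - fact (n + 1) / (w - u z) ^ (n + 2)) else (\<lambda>w. 0)) \<in> DK_coeffs"
    using DK_coeffs_pole_form[of "u z" "- fact (n + 1)" n] unfolding disc_def by (cases z) simp_all
qed

lemma coeff_pole_form:
  "z \<in> disc \<Longrightarrow> form_coeff (pole_form n z) w = - fact (n + 1) / (w - u z) ^ (n + 2)"
  by transfer simp

text \<open>
  \<open>eval_deriv n z\<close> sends \<open>a du\<close> to the \<open>n\<close>-th derivative of \<open>a\<close> at \<open>z\<close>, for \<open>z\<close> outside the
  disc and different from the pole of \<open>u\<close>; for other \<open>z\<close> it is set to 0.
\<close>

definition eval_deriv :: "nat \<Rightarrow> proj_line \<Rightarrow> DK \<Rightarrow> complex" where
  "eval_deriv n z a = (if z \<in> disc \<or> z = Infty then 0 else (deriv ^^ n) (form_coeff a) (u z))"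

lemma eval_deriv_add: "eval_deriv n z (DK_add a b) = eval_deriv n z a + eval_deriv n z b"
proof (cases "z \<in> disc \<or> z = Infty")
  case False
  then have z: "norm (u z) \<ge> 1" by (auto simp: disc_def)
  have a: "form_coeff a analytic_on {u z}" "form_coeff b analytic_on {u z}"
    using form_coeff DK_analytic z by blast+
  then have "(\<lambda>w. form_coeff a w + form_coeff b w) analytic_on {u z}" by (intro analytic_intros)
  then have "eventually (\<lambda>w. remove_sings (\<lambda>w. form_coeff a w + form_coeff b w) w = form_coeff a w + form_coeff b w) (nhds (u z))"
    by (rule eventually_remove_sings_eq_nhds)
  then have "(deriv ^^ n) (remove_sings (\<lambda>w. form_coeff a w + form_coeff b w)) (u z)
      = (deriv ^^ n) (\<lambda>w. form_coeff a w + form_coeff b w) (u z)"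
    by (rule higher_deriv_cong_ev) simp
  then show ?thesis
    using False a by (simp add: eval_deriv_def DK_add.rep_eq higher_deriv_add_at)
qed (auto simp: eval_deriv_def)

lemma eval_deriv_scale: "eval_deriv n z (DK_scale c a) = c * eval_deriv n z a"
proof (cases "z \<in> disc \<or> z = Infty")
  case False
  then have z: "norm (u z) \<ge> 1" by (auto simp: disc_def)
  have "form_coeff a analytic_on {u z}"
    using form_coeff DK_analytic z by blast
  then show ?thesis
    using False by (simp add: eval_deriv_def DK_scale.rep_eq higher_deriv_cmult')
qed (auto simp: eval_deriv_def)

section \<open>The symmetric algebra\<close>

text \<open>
  \<open>DK multiset \<Rightarrow>\<^sub>0 complex\<close> is the free commutative complex algebra on the set \<open>DK\<close>, the
  polynomial ring with one variable for each element of \<open>DK\<close>. The symmetric algebra of the vector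
  space \<open>DK\<close> is its quotient by the ideal expressing that the inclusion of \<open>DK\<close> is linear.
\<close>

type_synonym free_alg = "DK multiset \<Rightarrow>\<^sub>0 complex"

definition free_var :: "DK \<Rightarrow> free_alg" where
  "free_var a = Poly_Mapping.single {#a#} 1"

definition free_const :: "complex \<Rightarrow> free_alg" where
  "free_const c = Poly_Mapping.single 0 c"

definition sym_rels :: "free_alg set" where
  "sym_rels =
     {free_var (DK_add a b) - (free_var a + free_var b) | a b. True} \<union>
     {free_var (DK_scale c a) - free_const c * free_var a | c a. True}"

definition sym_ideal :: "free_alg set" where
  "sym_ideal = module.span (*) sym_rels"

lemma module_mult: "module ((*) :: free_alg \<Rightarrow> free_alg \<Rightarrow> free_alg)"
  by unfold_locales (auto simp: algebra_simps)

lemmas ideal_zero = module.span_zero[OF module_mult, of sym_rels, folded sym_ideal_def]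
  and ideal_add = module.span_add[OF module_mult, of _ sym_rels, folded sym_ideal_def]
  and ideal_diff = module.span_diff[OF module_mult, of _ sym_rels, folded sym_ideal_def]
  and ideal_neg = module.span_neg[OF module_mult, of _ sym_rels, folded sym_ideal_def]
  and ideal_mult = module.span_scale[OF module_mult, of _ sym_rels, folded sym_ideal_def]

definition sym_eq :: "free_alg \<Rightarrow> free_alg \<Rightarrow> bool" where
  "sym_eq p q \<longleftrightarrow> p - q \<in> sym_ideal"

lemma sym_eq_refl: "p = q \<Longrightarrow> sym_eq p q"
  by (simp add: sym_eq_def ideal_zero)

lemma equivp_sym_eq: "equivp sym_eq"
proof (rule equivpI)
  show "reflp sym_eq" by (auto simp: reflp_def sym_eq_def ideal_zero)
  show "symp sym_eq"
  proof (rule sympI)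
    fix p q assume "sym_eq p q"
    then show "sym_eq q p" using ideal_neg[of "p - q"] by (simp add: sym_eq_def)
  qed
  show "transp sym_eq"
  proof (rule transpI)
    fix p q r assume "sym_eq p q" "sym_eq q r"
    then show "sym_eq p r" using ideal_add[of "p - q" "q - r"] by (simp add: sym_eq_def)
  qed
qed

lemma poly_mapping_additive_induct [case_names single add]:
  fixes p :: "'a \<Rightarrow>\<^sub>0 'b::comm_monoid_add"
  assumes single: "\<And>m c. P (Poly_Mapping.single m c)"
    and add: "\<And>p q. P p \<Longrightarrow> P q \<Longrightarrow> P (p + q)"
  shows "P p"
proof (induction p rule: update_induct)
  case const
  show ?case using single[of _ 0] by simp
next
  case (update f a b)
  have "Poly_Mapping.update a b f = f + Poly_Mapping.single a b"
    using update(1)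
    by (intro poly_mapping_eqI) (auto simp: lookup_update lookup_add lookup_single in_keys_iff)
  then show ?case using update add single by metis
qed

lemma lookup_mult_empty:
  fixes p q :: free_alg
  shows "Poly_Mapping.lookup (p * q) 0 = Poly_Mapping.lookup p 0 * Poly_Mapping.lookup q 0"
proof (induction p rule: poly_mapping_additive_induct)
  case (single m c)
  show ?case
    by (induction q rule: poly_mapping_additive_induct)
      (auto simp: mult_single lookup_single when_def lookup_add algebra_simps)
qed (simp add: lookup_add algebra_simps)

lemma ideal_induct [consumes 1, case_names zero step]:
  assumes "p \<in> sym_ideal" "P 0"
    and "\<And>r g q. g \<in> sym_rels \<Longrightarrow> q \<in> sym_ideal \<Longrightarrow> P q \<Longrightarrow> P (r * g + q)"
  shows "P p"
proof -
  have "p \<in> sym_ideal \<and> P p"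
    using assms(1) unfolding sym_ideal_def
  proof (induction rule: module.span_induct_alt[OF module_mult, consumes 1])
    case 1
    then show ?case using assms(2) ideal_zero by (simp add: sym_ideal_def)
  next
    case (2 c x y)
    then have "c * x \<in> sym_ideal"
      by (intro ideal_mult) (auto simp: sym_ideal_def module.span_base[OF module_mult])
    then show ?case using 2 assms(3) ideal_add by (simp add: sym_ideal_def)
  qed
  then show ?thesis ..
qed

lemma one_notin_sym_ideal: "1 \<notin> sym_ideal"
proof
  assume "1 \<in> sym_ideal"
  have "Poly_Mapping.lookup p 0 = 0" if "p \<in> sym_ideal" for p
    using that
  proof (induction rule: ideal_induct)
    case (step r g q)
    have "Poly_Mapping.lookup g 0 = 0"
      using step(1)
      by (auto simp: sym_rels_def free_var_def free_const_def lookup_add lookup_minus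
          lookup_single mult_single)
    then show ?case using step by (simp add: lookup_add lookup_mult_empty)
  qed simp
  from this[OF \<open>1 \<in> sym_ideal\<close>] show False by simp
qed

quotient_type DW = free_alg / sym_eq
  by (rule equivp_sym_eq)

instantiation DW :: comm_ring_1
begin

lift_definition zero_DW :: DW is 0 .
lift_definition one_DW :: DW is 1 .
lift_definition plus_DW :: "DW \<Rightarrow> DW \<Rightarrow> DW" is "(+)"
  unfolding sym_eq_def by (metis add_diff_add ideal_add)
lift_definition minus_DW :: "DW \<Rightarrow> DW \<Rightarrow> DW" is "(-)"
proof -
  fix p p' q q' :: free_alg
  assume "sym_eq p p'" "sym_eq q q'"
  then have "(p - p') - (q - q') \<in> sym_ideal"
    by (auto simp: sym_eq_def intro!: ideal_diff)
  also have "(p - p') - (q - q') = (p - q) - (p' - q')" by simp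
  finally show "sym_eq (p - q) (p' - q')" by (simp add: sym_eq_def)
qed
lift_definition uminus_DW :: "DW \<Rightarrow> DW" is uminus
  unfolding sym_eq_def by (metis minus_diff_minus ideal_neg)
lift_definition times_DW :: "DW \<Rightarrow> DW \<Rightarrow> DW" is "(*)"
proof -
  fix p p' q q' :: free_alg
  assume "sym_eq p p'" "sym_eq q q'"
  then have "q * (p - p') + p' * (q - q') \<in> sym_ideal"
    by (auto simp: sym_eq_def intro!: ideal_add ideal_mult)
  also have "q * (p - p') + p' * (q - q') = p * q - p' * q'" by (simp add: algebra_simps)
  finally show "sym_eq (p * q) (p' * q')" by (simp add: sym_eq_def)
qed

instance
proof
  show "(0::DW) \<noteq> 1"
    by transfer (use ideal_neg one_notin_sym_ideal in \<open>force simp: sym_eq_def\<close>)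
qed (transfer; rule sym_eq_refl; simp add: algebra_simps; fail)+

end

lift_definition DW_scale :: "complex \<Rightarrow> DW \<Rightarrow> DW" is
  "\<lambda>c p. free_const c * p"
  unfolding sym_eq_def by (metis ideal_mult right_diff_distrib)

lift_definition incl :: "DK \<Rightarrow> DW" is free_var .

lemma incl_add: "incl (DK_add a b) = incl a + incl b"
proof (transfer, unfold sym_eq_def sym_ideal_def)
  fix a b
  show "free_var (DK_add a b) - (free_var a + free_var b) \<in> module.span (*) sym_rels"
    by (rule module.span_base[OF module_mult]) (auto simp: sym_rels_def)
qed

lemma incl_scale: "incl (DK_scale c a) = DW_scale c (incl a)"
proof (transfer, unfold sym_eq_def sym_ideal_def)
  fix c a
  show "free_var (DK_scale c a) - free_const c * free_var a \<in> module.span (*) sym_rels"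
    by (rule module.span_base[OF module_mult]) (auto simp: sym_rels_def)
qed

text \<open>
  The derivation of the free algebra with prescribed values on the variables; it descends to the
  symmetric algebra when these values depend linearly on the variable.
\<close>

definition free_deriv_mono :: "(DK \<Rightarrow> complex) \<Rightarrow> DK multiset \<Rightarrow> free_alg" where
  "free_deriv_mono f m = (\<Sum>a\<in>#m. Poly_Mapping.single (m - {#a#}) (f a))"

definition free_deriv :: "(DK \<Rightarrow> complex) \<Rightarrow> free_alg \<Rightarrow> free_alg" where
  "free_deriv f p =
     (\<Sum>m\<in>Poly_Mapping.keys p. free_const (Poly_Mapping.lookup p m) * free_deriv_mono f m)"

lemma free_deriv_add: "free_deriv f (p + q) = free_deriv f p + free_deriv f q"
  unfolding free_deriv_def
  by (rule setsum_keys_plus_distrib) (auto simp: free_const_def single_add algebra_simps)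

lemma free_deriv_single:
  "free_deriv f (Poly_Mapping.single m c) = free_const c * free_deriv_mono f m"
  by (cases "c = 0") (auto simp: free_deriv_def free_const_def)

lemma free_deriv_mono_add:
  "free_deriv_mono f (m + n) =
     free_deriv_mono f m * Poly_Mapping.single n 1 + Poly_Mapping.single m 1 * free_deriv_mono f n"
proof -
  have "(\<Sum>a\<in>#m. Poly_Mapping.single (m + n - {#a#}) (f a)) = free_deriv_mono f m * Poly_Mapping.single n 1"
    unfolding free_deriv_mono_def sum_mset_distrib_right
    by (rule arg_cong[of _ _ sum_mset], rule image_mset_cong) (simp add: mult_single)
  moreover have "(\<Sum>a\<in>#n. Poly_Mapping.single (m + n - {#a#}) (f a)) = Poly_Mapping.single m 1 * free_deriv_mono f n"
    unfolding free_deriv_mono_def sum_mset_distrib_left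
    by (rule arg_cong[of _ _ sum_mset], rule image_mset_cong) (simp add: mult_single)
  ultimately show ?thesis by (simp add: free_deriv_mono_def)
qed

lemma free_deriv_mult: "free_deriv f (p * q) = free_deriv f p * q + p * free_deriv f q"
proof (induction p rule: poly_mapping_additive_induct)
  case (single m c)
  show ?case
  proof (induction q rule: poly_mapping_additive_induct)
    case (single n d)
    have c: "free_const (c * d) = free_const c * free_const d"
      and s: "Poly_Mapping.single k e = free_const e * Poly_Mapping.single k 1" for k e
      by (auto simp: free_const_def mult_single)
    show ?case
      unfolding mult_single free_deriv_single free_deriv_mono_add c
      by (simp add: s[of m c] s[of n d] algebra_simps)
  qed (simp add: free_deriv_add algebra_simps)
qed (simp add: free_deriv_add algebra_simps)

lemma free_deriv_diff: "free_deriv f (p - q) = free_deriv f p - free_deriv f q"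
  by (metis add_diff_cancel_right' diff_add_cancel free_deriv_add)

lemma free_deriv_var: "free_deriv f (free_var a) = free_const (f a)"
  by (simp add: free_var_def free_deriv_single free_deriv_mono_def free_const_def mult_single)

lemma free_deriv_const: "free_deriv f (free_const c) = 0"
  by (simp add: free_const_def free_deriv_single free_deriv_mono_def)

lemma free_deriv_zero: "free_deriv f 0 = 0"
  by (simp add: free_deriv_def)

lemma free_deriv_ideal:
  assumes add: "\<And>a b. f (DK_add a b) = f a + f b"
    and scale: "\<And>c a. f (DK_scale c a) = c * f a"
    and p: "p \<in> sym_ideal"
  shows "free_deriv f p \<in> sym_ideal"
  using p
proof (induction rule: ideal_induct)
  case zero
  show ?case by (simp add: free_deriv_zero ideal_zero)
next
  case (step r g q)
  have "free_deriv f g = 0"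
    using step(1)
    by (auto simp: sym_rels_def free_deriv_diff free_deriv_add free_deriv_mult free_deriv_var
        free_deriv_const add scale)
      (auto simp: free_const_def single_add mult_single)
  moreover have "g \<in> sym_ideal"
    using step(1) by (simp add: sym_ideal_def module.span_base[OF module_mult])
  ultimately show ?case
    using step by (auto simp: free_deriv_add free_deriv_mult intro!: ideal_add ideal_mult)
qed

section \<open>The fields\<close>

text \<open>
  \<open>e_deriv n\<close> and \<open>i_deriv n\<close> are the \<open>n\<close>-th derivatives of the fields \<open>e_hat\<close> and \<open>i_hat\<close>:
  multiplication by \<open>pole_form n z\<close>, and the derivation with value \<open>- eval_deriv n z a\<close> on
  \<open>a du\<close>. The values of \<open>e_hat\<close> outside the disc, and of \<open>i_hat\<close> in the disc and at the pole
  of \<open>u\<close>, are meaningless.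
\<close>

definition e_deriv :: "nat \<Rightarrow> proj_line \<Rightarrow> DW \<Rightarrow> DW" where
  "e_deriv n z \<psi> = incl (pole_form n z) * \<psi>"

lift_definition i_deriv :: "nat \<Rightarrow> proj_line \<Rightarrow> DW \<Rightarrow> DW" is
  "\<lambda>n z. free_deriv (\<lambda>a. - eval_deriv n z a)"
  unfolding sym_eq_def
  by (subst free_deriv_diff[symmetric], rule free_deriv_ideal)
    (simp_all add: eval_deriv_add eval_deriv_scale)

definition e_hat :: "proj_line \<Rightarrow> DW \<Rightarrow> DW" where
  "e_hat = e_deriv 0"

definition i_hat :: "proj_line \<Rightarrow> DW \<Rightarrow> DW" where
  "i_hat = i_deriv 0"

lemma i_deriv_add: "i_deriv n z (\<phi> + \<psi>) = i_deriv n z \<phi> + i_deriv n z \<psi>"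
  by transfer (simp add: free_deriv_add sym_eq_def ideal_zero)

lemma i_deriv_mult: "i_deriv n z (\<phi> * \<psi>) = i_deriv n z \<phi> * \<psi> + \<phi> * i_deriv n z \<psi>"
  by transfer (simp add: free_deriv_mult sym_eq_def ideal_zero)

lemma i_deriv_scale: "i_deriv n z (DW_scale c \<psi>) = DW_scale c (i_deriv n z \<psi>)"
  by transfer (simp add: free_deriv_mult free_deriv_const sym_eq_def ideal_zero)

lemma i_deriv_one: "i_deriv n z 1 = 0"
  using i_deriv_mult[of n z 1 1] by simp

lemma i_hat_incl:
  assumes "z \<notin> disc" "z \<noteq> Infty"
  shows "i_hat z (incl a) = DW_scale (- form_coeff a (u z)) 1"
  using assms unfolding i_hat_def
  by transfer (simp add: free_deriv_var eval_deriv_def sym_eq_def ideal_zero)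

section \<open>The hermitian form\<close>

definition hermitian_form :: "(DW \<Rightarrow> DW \<Rightarrow> complex) \<Rightarrow> bool" where
  "hermitian_form H \<longleftrightarrow>
     (\<forall>\<phi> \<psi> \<psi>'. H \<phi> (\<psi> + \<psi>') = H \<phi> \<psi> + H \<phi> \<psi>') \<and>
     (\<forall>\<phi> c \<psi>. H \<phi> (DW_scale c \<psi>) = c * H \<phi> \<psi>) \<and>
     (\<forall>\<phi> \<psi>. H \<psi> \<phi> = cnj (H \<phi> \<psi>))"

text \<open>
  Compatibility with derivatives means that derivatives of the fields in \<open>u(z)\<close> may be taken
  outside of the form. In particular \<open>(\<phi>, e_hat z \<psi>)\<close> is holomorphic on the disc. In the first
  argument the corresponding statement follows by hermitian symmetry.
\<close>

definition compatible_with_derivatives :: "(DW \<Rightarrow> DW \<Rightarrow> complex) \<Rightarrow> bool" where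
  "compatible_with_derivatives H \<longleftrightarrow>
     (\<forall>\<phi> \<psi> n z. Aff z \<in> disc \<longrightarrow>
        ((\<lambda>w. H \<phi> (e_deriv n (Aff w) \<psi>)) has_field_derivative
           H \<phi> (e_deriv (Suc n) (Aff z) \<psi>)) (at z)) \<and>
     (\<forall>\<phi> \<psi> n z. Aff z \<in> codisc \<longrightarrow>
        ((\<lambda>w. H \<phi> (i_deriv n (Aff w) \<psi>)) has_field_derivative
           H \<phi> (i_deriv (Suc n) (Aff z) \<psi>)) (at z))"

text \<open>
  The adjointness relations are stated where the field \<open>i_hat\<close> occurring in them is defined, that
  is, for \<open>u z \<noteq> 0\<close> in the disc and away from the pole of \<open>u\<close> in its complement. At \<open>u z = 0\<close>
  the form is determined by holomorphy in \<open>z\<close>.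
\<close>

definition vacuum_form :: "(DW \<Rightarrow> DW \<Rightarrow> complex) \<Rightarrow> bool" where
  "vacuum_form H \<longleftrightarrow>
     hermitian_form H \<and>
     compatible_with_derivatives H \<and>
     H 1 1 = 1 \<and>
     (\<forall>\<phi> \<psi>. \<forall>z\<in>disc. u z \<noteq> 0 \<longrightarrow>
        (u z)\<^sup>2 * H \<phi> (e_hat z \<psi>) = H (i_hat (invol z) \<phi>) \<psi>) \<and>
     (\<forall>\<phi> \<psi>. \<forall>z\<in>codisc. z \<noteq> Infty \<longrightarrow>
        (u z)\<^sup>2 * H \<phi> (i_hat z \<psi>) = H (e_hat (invol z) \<phi>) \<psi>)"

end

theory Submission
  imports Defs
begin

text \<open>
  Moving \<open>e_hat z\<close> to the left argument turns it into the derivation \<open>i_hat (invol z)\<close>, which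
  contracts \<open>z\<close> with one of the points \<open>y\<^sub>b\<close> and contributes the factor
  \<open>1 / (1 - u z * cnj (u y\<^sub>b))\<^sup>2\<close>. Contracting the last of the \<open>z\<close>'s in every possible way
  reproduces the decomposition of the permutations of \<open>{..n}\<close> as \<open>transpose n b \<circ> q\<close> with \<open>q\<close> a
  permutation of \<open>{..<n}\<close>.
\<close>

lemma DW_scale_mult_left: "DW_scale c \<phi> * \<psi> = DW_scale c (\<phi> * \<psi>)"
  by transfer (rule sym_eq_refl, simp add: mult.assoc)

text \<open>Since the algebra is commutative, a state is determined by a set of indices. Products
  over index sets make it easy to delete one index or to relabel the rest.\<close>

lemma foldr_e_hat: "foldr e_hat zs 1 = (\<Prod>j<length zs. incl (pole_form 0 (zs ! j)))"
proof (induction zs)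
  case (Cons z zs)
  then show ?case
    by (simp add: e_hat_def e_deriv_def prod.lessThan_Suc_shift del: prod.lessThan_Suc)
qed simp

text \<open>This is the Leibniz rule. The derivation sends each generator to a scalar, so every term
  loses exactly one factor.\<close>

lemma i_hat_prod_incl:
  assumes "w \<notin> disc" "w \<noteq> Infty" "finite A"
  shows "i_hat w (\<Prod>j\<in>A. incl (a j)) =
    (\<Sum>b\<in>A. DW_scale (- form_coeff (a b) (u w)) (\<Prod>j\<in>A-{b}. incl (a j)))"
  using \<open>finite A\<close>
proof (induction A)
  case empty
  show ?case by (simp add: i_hat_def i_deriv_one)
next
  case (insert x A)
  have "incl (a x) * DW_scale (- form_coeff (a b) (u w)) (\<Prod>j\<in>A-{b}. incl (a j)) =
      DW_scale (- form_coeff (a b) (u w)) (\<Prod>j\<in>insert x A-{b}. incl (a j))" if "b \<in> A" for b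
  proof -
    have "insert x A - {b} = insert x (A - {b})" using that insert.hyps by auto
    then show ?thesis
      using insert.hyps by (simp add: DW_scale_mult_left mult.commute[of "incl (a x)"])
  qed
  moreover have "insert x A - {x} = A" using insert.hyps by auto
  ultimately show ?case
    using insert i_hat_incl[OF assms(1,2), of "a x"]
    by (simp add: i_hat_def i_deriv_mult sum_distrib_left DW_scale_mult_left)
qed

lemma hermitian_form_scale_left:
  "hermitian_form H \<Longrightarrow> H (DW_scale c \<phi>) \<psi> = cnj c * H \<phi> \<psi>"
  unfolding hermitian_form_def by (metis complex_cnj_mult)

lemma hermitian_form_add_left:
  "hermitian_form H \<Longrightarrow> H (\<phi> + \<phi>') \<psi> = H \<phi> \<psi> + H \<phi>' \<psi>"
  unfolding hermitian_form_def by (metis complex_cnj_add)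

lemma hermitian_form_sum_left:
  assumes "hermitian_form H"
  shows "H (\<Sum>b\<in>A. f b) \<psi> = (\<Sum>b\<in>A. H (f b) \<psi>)"
proof -
  have "H 0 \<psi> = 0" using hermitian_form_add_left[OF assms, of 0 0] by simp
  then show ?thesis
    by (induction A rule: infinite_finite_induct) (simp_all add: hermitian_form_add_left[OF assms])
qed

lemma one_minus_mult_cnj_nonzero:
  fixes z y :: complex
  assumes "norm z < 1" "norm y < 1"
  shows "1 - z * cnj y \<noteq> 0"
proof
  assume "1 - z * cnj y = 0"
  then have "norm z * norm y = 1" by (metis complex_mod_cnj eq_iff_diff_eq_0 norm_mult norm_one)
  moreover have "norm z * norm y < 1 * 1" using assms by (intro mult_strict_mono') auto
  ultimately show False by simp
qed

text \<open>Up to the factor \<pi>, this is the Bergman kernel of the unit disc. It is the two-point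
  function, the case \<open>l = m = 1\<close> of the result.\<close>

definition contraction :: "complex \<Rightarrow> complex \<Rightarrow> complex" where
  "contraction z y = 1 / (1 - z * cnj y)\<^sup>2"

text \<open>Adjointness turns \<open>e_hat (Aff z)\<close> into the derivation at the mirror point
  \<open>1 / cnj z\<close>, and the Leibniz rule then expands the left state. The point 0 is
  excluded because its mirror image is the pole of \<open>u\<close>.\<close>

lemma vacuum_form_contract_nonzero:
  assumes H: "vacuum_form H" and A: "finite A" "\<And>j. j \<in> A \<Longrightarrow> y j \<in> disc"
    and z: "norm z < 1" "z \<noteq> 0"
  shows "H (\<Prod>j\<in>A. incl (pole_form 0 (y j))) (e_hat (Aff z) \<psi>) =
    (\<Sum>b\<in>A. contraction z (u (y b)) * H (\<Prod>j\<in>A-{b}. incl (pole_form 0 (y j))) \<psi>)"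
    (is "?L = (\<Sum>b\<in>A. _ * ?H b)")
proof -
  let ?w = "1 / cnj z"
  have w: "Aff ?w \<notin> disc" using z by (simp add: norm_divide divide_simps)
  have herm: "hermitian_form H" using H by (simp add: vacuum_form_def)
  \<comment> \<open>The sign of the derivation cancels that of the pole form. The conjugation comes
    from antilinearity in the first argument, and the factor \<open>z\<^sup>2\<close> is the one
    that adjointness puts on the other side.\<close>
  have coeff: "cnj (- form_coeff (pole_form 0 (y b)) ?w) = z\<^sup>2 * contraction z (u (y b))"
    if "b \<in> A" for b
  proof -
    have "norm (u (y b)) < 1" using A(2)[OF that] by (simp add: disc_def)
    then have "1 - z * cnj (u (y b)) \<noteq> 0" using one_minus_mult_cnj_nonzero z by blast
    moreover have "1 / z - cnj (u (y b)) = (1 - z * cnj (u (y b))) / z"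
      using z by (simp add: field_simps)
    ultimately show ?thesis
      using z by (simp add: coeff_pole_form A that contraction_def power_divide power2_eq_square)
  qed
  have "z\<^sup>2 * ?L = H (i_hat (Aff ?w) (\<Prod>j\<in>A. incl (pole_form 0 (y j)))) \<psi>"
    using H z unfolding vacuum_form_def by (metis Aff_in_disc invol.simps(2) proj_line.sel)
  also have "\<dots> = (\<Sum>b\<in>A. z\<^sup>2 * contraction z (u (y b)) * ?H b)"
    unfolding i_hat_prod_incl[OF w proj_line.distinct(1) A(1)]
      hermitian_form_sum_left[OF herm] hermitian_form_scale_left[OF herm] proj_line.sel
    by (intro sum.cong refl) (simp only: coeff)
  also have "\<dots> = z\<^sup>2 * (\<Sum>b\<in>A. contraction z (u (y b)) * ?H b)"
    by (simp add: sum_distrib_left mult.assoc)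
  finally show ?thesis using z by simp
qed

text \<open>Continuity in \<open>z\<close> supplies the point 0, about which adjointness says
  nothing directly.\<close>

lemma vacuum_form_contract:
  assumes H: "vacuum_form H" and A: "finite A" "\<And>j. j \<in> A \<Longrightarrow> y j \<in> disc" and z: "z \<in> disc"
  shows "H (\<Prod>j\<in>A. incl (pole_form 0 (y j))) (e_hat z \<psi>) =
    (\<Sum>b\<in>A. contraction (u z) (u (y b)) * H (\<Prod>j\<in>A-{b}. incl (pole_form 0 (y j))) \<psi>)"
proof (cases "u z = 0")
  case False
  obtain x where "z = Aff x" using z by (cases z) auto
  then show ?thesis
    using vacuum_form_contract_nonzero[OF H A(1), of y x \<psi>] A(2) z False by simp
next
  case True
  then have z0: "z = Aff 0" using z by (cases z) auto
  \<comment> \<open>Both functions agree on the punctured disc and are continuous at 0: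
    \<open>?f\<close> is differentiable by compatibility with derivatives, and the denominators in
    \<open>?g\<close> equal 1 there. Hence they agree at 0.\<close>
  let ?f = "\<lambda>w. H (\<Prod>j\<in>A. incl (pole_form 0 (y j))) (e_hat (Aff w) \<psi>)"
  let ?g = "\<lambda>w. \<Sum>b\<in>A. contraction w (u (y b)) * H (\<Prod>j\<in>A-{b}. incl (pole_form 0 (y j))) \<psi>"
  have "(?f has_field_derivative
      H (\<Prod>j\<in>A. incl (pole_form 0 (y j))) (e_deriv (Suc 0) (Aff 0) \<psi>)) (at 0)"
    using H unfolding vacuum_form_def compatible_with_derivatives_def e_hat_def by auto
  then have f: "?f \<midarrow>0\<rightarrow> ?f 0" using DERIV_isCont isCont_def by blast
  have "?g \<midarrow>0\<rightarrow> ?g 0" unfolding contraction_def by (intro tendsto_intros) auto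
  moreover have "eventually (\<lambda>w. ?g w = ?f w) (at 0)"
  proof -
    have "eventually (\<lambda>w. w \<in> ball 0 1 - {0}) (at (0::complex))"
      by (intro eventually_at_in_open) auto
    then show ?thesis
      by eventually_elim (use vacuum_form_contract_nonzero[OF H A(1), of y] A(2) in auto)
  qed
  ultimately have "?f \<midarrow>0\<rightarrow> ?g 0" using tendsto_cong by fast
  then show ?thesis using f z0 tendsto_unique[OF at_neq_bot] by fastforce
qed

text \<open>The induction removes the last \<open>z\<close>. Both \<open>l\<close> and
  \<open>y\<close> stay arbitrary because the contraction deletes any one of the \<open>y\<close>'s,
  and the remaining ones are relabelled.\<close>

lemma vacuum_form_prod:
  fixes l m :: nat
  assumes H: "vacuum_form H"
    and "\<And>j. j < l \<Longrightarrow> y j \<in> disc" and "\<And>j. j < m \<Longrightarrow> z j \<in> disc"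
  shows "H (\<Prod>j<l. incl (pole_form 0 (y j))) (\<Prod>j<m. incl (pole_form 0 (z j))) =
    (if l \<noteq> m then 0
     else \<Sum>\<sigma> | \<sigma> permutes {..<m}. \<Prod>j<m. contraction (u (z j)) (u (y (\<sigma> j))))"
  using assms(2,3)
proof (induction m arbitrary: l y)
  case 0
  show ?case
  proof (cases l)
    case 0
    then show ?thesis using H by (simp add: vacuum_form_def)
  next
    case (Suc n)
    let ?\<phi> = "\<Prod>j<n. incl (pole_form 0 (y j))"
    \<comment> \<open>With no \<open>z\<close> left, a field is taken from the \<open>y\<close>'s
      instead: against the vacuum its contraction is an empty sum, and hermitian symmetry carries
      the zero over.\<close>
    have "H 1 (e_hat (y n) ?\<phi>) = 0"
      using vacuum_form_contract[OF H, of "{}" y "y n"] 0 Suc by simp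
    moreover have "H (e_hat (y n) ?\<phi>) 1 = cnj (H 1 (e_hat (y n) ?\<phi>))"
      using H unfolding vacuum_form_def hermitian_form_def by blast
    ultimately show ?thesis
      using Suc by (simp add: e_hat_def e_deriv_def mult.commute)
  qed
next
  case (Suc m)
  let ?\<psi> = "\<Prod>j<m. incl (pole_form 0 (z j))"
  let ?g = "\<lambda>j b. contraction (u (z j)) (u (y b))"
  have expand: "H (\<Prod>j<l. incl (pole_form 0 (y j))) (\<Prod>j<Suc m. incl (pole_form 0 (z j))) =
      (\<Sum>b<l. ?g m b * H (\<Prod>j\<in>{..<l}-{b}. incl (pole_form 0 (y j))) ?\<psi>)"
    using vacuum_form_contract[OF H, of "{..<l}" y "z m" ?\<psi>] Suc.prems
    by (simp add: e_hat_def e_deriv_def mult.commute)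
  show ?case
  proof (cases l)
    case 0
    with expand show ?thesis by simp
  next
    case l: (Suc n)
    let ?t = "Transposition.transpose n"
    \<comment> \<open>The last index \<open>n\<close> fills the gap left by \<open>b\<close>; for
      \<open>b = n\<close> the transposition is the identity.\<close>
    have reindex: "(\<Prod>j\<in>{..<l}-{b}. incl (pole_form 0 (y j))) =
        (\<Prod>j<n. incl (pole_form 0 (y (?t b j))))" if "b < l" for b
    proof (rule prod.reindex_bij_witness[of _ "?t b" "?t b"])
      fix j assume "j \<in> {..<l} - {b}"
      then show "?t b j \<in> {..<n}" using that l by (auto simp: Transposition.transpose_def)
    next
      fix j assume "j \<in> {..<n}"
      then show "?t b j \<in> {..<l} - {b}" using that l by (auto simp: Transposition.transpose_def)
    qed auto
    have IH: "H (\<Prod>j\<in>{..<l}-{b}. incl (pole_form 0 (y j))) ?\<psi> =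
        (if n \<noteq> m then 0
         else \<Sum>\<sigma> | \<sigma> permutes {..<m}. \<Prod>j<m. ?g j (?t b (\<sigma> j)))" if "b < l" for b
      unfolding reindex[OF that]
      using that l Suc.prems by (intro Suc.IH) (auto simp: Transposition.transpose_def)
    show ?thesis
    proof (cases "n = m")
      case False
      then have "(\<Sum>b<l. ?g m b * H (\<Prod>j\<in>{..<l}-{b}. incl (pole_form 0 (y j))) ?\<psi>) = 0"
        by (intro sum.neutral) (simp add: IH)
      then show ?thesis unfolding expand using l False by simp
    next
      case True
      have "(\<Sum>\<sigma> | \<sigma> permutes {..<Suc m}. \<Prod>j<Suc m. ?g j (\<sigma> j)) =
          (\<Sum>b<Suc m. \<Sum>q | q permutes {..<m}. \<Prod>j<Suc m. ?g j ((?t b \<circ> q) j))"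
        unfolding lessThan_Suc True
        by (rule sum_over_permutations_insert) auto
      also have "\<dots> = (\<Sum>b<Suc m. ?g m b * (\<Sum>q | q permutes {..<m}. \<Prod>j<m. ?g j (?t b (q j))))"
      proof (intro sum.cong refl)
        fix b
        \<comment> \<open>As \<open>q\<close> fixes \<open>m\<close>, which equals \<open>n\<close>,
          the composite sends \<open>m\<close> to \<open>b\<close>; this splits off the last
          factor.\<close>
        have "(\<Prod>j<Suc m. ?g j ((?t b \<circ> q) j)) = ?g m b * (\<Prod>j<m. ?g j (?t b (q j)))"
          if "q permutes {..<m}" for q
          using permutes_not_in[OF that, of m] by (simp add: True mult.commute)
        then show "(\<Sum>q | q permutes {..<m}. \<Prod>j<Suc m. ?g j ((?t b \<circ> q) j)) =
            ?g m b * (\<Sum>q | q permutes {..<m}. \<Prod>j<m. ?g j (?t b (q j)))"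
          unfolding sum_distrib_left by (intro sum.cong refl) blast
      qed
      also have "\<dots> = (\<Sum>b<l. ?g m b * H (\<Prod>j\<in>{..<l}-{b}. incl (pole_form 0 (y j))) ?\<psi>)"
        unfolding True[symmetric] l[symmetric]
        by (intro sum.cong refl) (simp only: True IH lessThan_iff if_False simp_thms)
      finally show ?thesis unfolding expand using l True by simp
    qed
  qed
qed

theorem proposition7p9:
  fixes H :: "DW \<Rightarrow> DW \<Rightarrow> complex" and ys zs :: "proj_line list"
  assumes "vacuum_form H"
    and "set ys \<subseteq> disc" and "distinct ys"
    and "set zs \<subseteq> disc" and "distinct zs"
  shows "H (foldr e_hat ys 1) (foldr e_hat zs 1) =
    (if length ys \<noteq> length zs then 0
     else \<Sum>\<sigma> | \<sigma> permutes {..<length zs}.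
            \<Prod>j<length zs. 1 / (1 - u (zs ! j) * cnj (u (ys ! \<sigma> j)))\<^sup>2)"
proof -
  have "ys ! j \<in> disc" if "j < length ys" for j using that assms(2) nth_mem by blast
  moreover have "zs ! j \<in> disc" if "j < length zs" for j using that assms(4) nth_mem by blast
  ultimately show ?thesis
    unfolding foldr_e_hat
    using vacuum_form_prod[OF assms(1), of "length ys" "(!) ys" "length zs" "(!) zs"]
    by (simp add: contraction_def)
qed

end
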